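(* Place four point masses $m_1,m_2,m_3,m_4$ at $q_1=(0,0)$, $q_2=(0,a)$, $q_3=(1,b)$, $q_4=(1,c)$ respectively, where $a\ge 1$ and $b>c$, and let $r_{ij}=\|q_i-q_j\|$. Then, under the labelling convention described in the context, the set $\Omega$ of triples $(a,b,c)$ that are realizable as central configurations (with positive masses) is $$\Omega=\{(a,b,c)\in\mathbb{R}^3 : a\ge 1,\ b>c,\ D=0,\ r_{24}\ge r_{13}>r_{12}\ge r_{23}\ge r_{14}\ge r_{34}\},$$ and the boundary of $\Omega$ (in the sense given in the context) is $\mathcal{C}_1\cup\mathcal{C}_2\cup\mathcal{C}_3\cup\{P_1\}\cup\{P_2\}\cup\{P_3\}$, where $$\mathcal{C}_1=\{(2/\sqrt3,\,1/\sqrt3,\,c): c\in(-1/\sqrt3,1/\sqrt3)\},$$ $$\mathcal{C}_2=\{(\sqrt{1+c^2},\,c+\sqrt{1+c^2},\,c): c\in(-1/\sqrt3,0)\},$$ $$\mathcal{C}_3=\{(a,b,c): a=b+c,\ f(b,c)=0,\ c\in(0,1/\sqrt3)\},$$ $$P_1=(2/\sqrt3,1/\sqrt3,1/\sqrt3),\quad P_2=(2/\sqrt3,1/\sqrt3,-1/\sqrt3),\quad P_3=(1,1,0),$$ and $$f(b,c)=\big((b+c)^3-(c^2+1)^{3/2}\big)\big((b^2+1)^{3/2}-(b-c)^3\big)-\big((b^2+1)^{3/2}-(b+c)^3\big)\big((c^2+1)^{3/2}-(b-c)^3\big).$$ Moreover: the points of $\mathcal{C}_1$ give configurations of the restricted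 problem with $m_1,m_2,m_3$ at the vertices of an equilateral triangle; the points of $\mathcal{C}_2$ and $\mathcal{C}_3$ give rhombus and isosceles trapezoid central configurations, respectively; $P_1$ corresponds to an equilateral triangle configuration of the restricted problem with a collision of $m_3$ and $m_4$ at one of the vertices; $P_2$ corresponds to a configuration of the restricted problem with the masses at the vertices of a rhombus such that the positions of $m_1,m_2,m_3$ are the vertices of an equilateral triangle; and $P_3$ corresponds to the square central configuration.
   Context: A configuration $(q_1,\dots,q_4)$ of pairwise distinct points of $\mathbb{R}^2$ with masses $m_1,\dots,m_4$ is a central configuration if there is $\lambda>0$ with $\sum_{j\ne k} m_j\,(q_j-q_k)/\|q_j-q_k\|^3=-\lambda\,(q_k-\mathbf{c})$ for all $k$, where $\mathbf{c}=\sum m_kq_k/\sum m_k$ is the center of mass. A triple $(a,b,c)$ is realizable if there are positive masses $m_1,\dots,m_4$ making $(q_1,q_2,q_3,q_4)$ a central configuration. Labelling convention (no loss of generality up to relabelling and rescaling): the bodies are labelled so that $r_{12}$ is a longest side of the quadrilateral $q_1q_2q_3q_4$, $r_{23}\ge r_{14}$, and $r_{24}\ge r_{13}$. Here $r_{24}=\sqrt{1+(a-c)^2}$, $r_{13}=\sqrt{1+b^2}$, $r_{12}=a$, $r_{23}=\sqrt{1+(a-b)^2}$, $r_{14}=\sqrt{1+c^2}$, $r_{34}=b-c$, and $$D=(r_{13}^3-r_{12}^3)(r_{23}^3-r_{34}^3)(r_{24}^3-r_{14}^3)-(r_{12}^3-r_{14}^3)(r_{24}^3-r_{34}^3)(r_{13}^3-r_{23}^3).$$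 Boundary of $\Omega$: the set of $(a,b,c)$ with $a\ge1$, $b\ge c$, $D=0$, $r_{24}\ge r_{13}\ge r_{12}\ge r_{23}\ge r_{14}\ge r_{34}$ for which at least one of these last five inequalities is an equality. "Configuration of the restricted problem" means a configuration in which one or more of the masses are zero. An isosceles trapezoid has two parallel sides (bases), and its two other sides (lateral sides) have equal length, with base angles equal. *)

theory Defs
  imports "HOL-Analysis.Analysis"
begin

definition center_of_mass :: "real^4 \<Rightarrow> real^2^4 \<Rightarrow> real^2" where
  "center_of_mass m q = (1 / (\<Sum>k\<in>UNIV. m $ k)) *\<^sub>R (\<Sum>k\<in>UNIV. (m $ k) *\<^sub>R (q $ k))"

definition central_configuration :: "real^4 \<Rightarrow> real^2^4 \<Rightarrow> bool" where
  "central_configuration m q \<longleftrightarrow>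
     (\<forall>i j. i \<noteq> j \<longrightarrow> q $ i \<noteq> q $ j) \<and>
     (\<exists>\<mu>>0. \<forall>k.
        (\<Sum>j\<in>UNIV - {k}. (m $ j / norm (q $ j - q $ k) ^ 3) *\<^sub>R (q $ j - q $ k)) =
          - (\<mu> *\<^sub>R (q $ k - center_of_mass m q)))"

text \<open>
  In a configuration with collisions the mutual attraction of two coinciding bodies is undefined.
  The equations below keep the attraction between distinct positions only; for pairwise distinct
  positions they are the equations of a central configuration.
\<close>

definition collision_central_configuration :: "real^4 \<Rightarrow> real^2^4 \<Rightarrow> bool" where
  "collision_central_configuration m q \<longleftrightarrow>
     (\<exists>i j. i \<noteq> j \<and> q $ i = q $ j) \<and>
     (\<exists>\<mu>>0. \<forall>k.
        (\<Sum>j\<in>{j. q $ j \<noteq> q $ k}. (m $ j / norm (q $ j - q $ k) ^ 3) *\<^sub>R (q $ j - q $ k)) =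
          - (\<mu> *\<^sub>R (q $ k - center_of_mass m q)))"

text \<open>
  The restricted problem: some mass vanishes. Two masses are required to be positive in order to
  exclude the empty case (no center of mass) and the degenerate case of a single attracting body.
\<close>

definition restricted_masses :: "real^4 \<Rightarrow> bool" where
  "restricted_masses m \<longleftrightarrow>
     (\<forall>i. 0 \<le> m $ i) \<and> (\<exists>i. m $ i = 0) \<and> 2 \<le> card {i. 0 < m $ i}"

definition positions :: "real \<Rightarrow> real \<Rightarrow> real \<Rightarrow> real^2^4" where
  "positions a b c = vector [vector [0, 0], vector [0, a], vector [1, b], vector [1, c]]"

definition r :: "real \<Rightarrow> real \<Rightarrow> real \<Rightarrow> 4 \<Rightarrow> 4 \<Rightarrow> real" where
  "r a b c i j = norm (positions a b c $ i - positions a b c $ j)"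

definition D :: "real \<Rightarrow> real \<Rightarrow> real \<Rightarrow> real" where
  "D a b c =
     (r a b c 1 3 ^ 3 - r a b c 1 2 ^ 3) * (r a b c 2 3 ^ 3 - r a b c 3 4 ^ 3)
       * (r a b c 2 4 ^ 3 - r a b c 1 4 ^ 3)
     - (r a b c 1 2 ^ 3 - r a b c 1 4 ^ 3) * (r a b c 2 4 ^ 3 - r a b c 3 4 ^ 3)
       * (r a b c 1 3 ^ 3 - r a b c 2 3 ^ 3)"

definition realizable :: "real \<Rightarrow> real \<Rightarrow> real \<Rightarrow> bool" where
  "realizable a b c \<longleftrightarrow>
     (\<exists>m. (\<forall>i. 0 < m $ i) \<and> central_configuration m (positions a b c))"

definition labelling_convention :: "real \<Rightarrow> real \<Rightarrow> real \<Rightarrow> bool" where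
  "labelling_convention a b c \<longleftrightarrow>
     r a b c 1 2 \<ge> r a b c 2 3 \<and> r a b c 1 2 \<ge> r a b c 3 4 \<and> r a b c 1 2 \<ge> r a b c 1 4 \<and>
     r a b c 2 3 \<ge> r a b c 1 4 \<and> r a b c 2 4 \<ge> r a b c 1 3"

definition Omega :: "(real \<times> real \<times> real) set" where
  "Omega = {(a, b, c). a \<ge> 1 \<and> b > c \<and> labelling_convention a b c \<and> realizable a b c}"

definition boundary_Omega :: "(real \<times> real \<times> real) set" where
  "boundary_Omega =
     {(a, b, c). a \<ge> 1 \<and> b \<ge> c \<and> D a b c = 0 \<and>
        r a b c 2 4 \<ge> r a b c 1 3 \<and> r a b c 1 3 \<ge> r a b c 1 2 \<and> r a b c 1 2 \<ge> r a b c 2 3 \<and>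
        r a b c 2 3 \<ge> r a b c 1 4 \<and> r a b c 1 4 \<ge> r a b c 3 4 \<and>
        (r a b c 2 4 = r a b c 1 3 \<or> r a b c 1 3 = r a b c 1 2 \<or> r a b c 1 2 = r a b c 2 3 \<or>
         r a b c 2 3 = r a b c 1 4 \<or> r a b c 1 4 = r a b c 3 4)}"

definition f :: "real \<Rightarrow> real \<Rightarrow> real" where
  "f b c =
     ((b + c) ^ 3 - (c\<^sup>2 + 1) powr (3/2)) * ((b\<^sup>2 + 1) powr (3/2) - (b - c) ^ 3)
     - ((b\<^sup>2 + 1) powr (3/2) - (b + c) ^ 3) * ((c\<^sup>2 + 1) powr (3/2) - (b - c) ^ 3)"

definition C1 :: "(real \<times> real \<times> real) set" where
  "C1 = {(2 / sqrt 3, 1 / sqrt 3, c) | c. c \<in> {-(1 / sqrt 3)<..<1 / sqrt 3}}"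

definition C2 :: "(real \<times> real \<times> real) set" where
  "C2 = {(sqrt (1 + c\<^sup>2), c + sqrt (1 + c\<^sup>2), c) | c. c \<in> {-(1 / sqrt 3)<..<0}}"

definition C3 :: "(real \<times> real \<times> real) set" where
  "C3 = {(a, b, c). a = b + c \<and> f b c = 0 \<and> c \<in> {0<..<1 / sqrt 3}}"

definition P1 :: "real \<times> real \<times> real" where
  "P1 = (2 / sqrt 3, 1 / sqrt 3, 1 / sqrt 3)"

definition P2 :: "real \<times> real \<times> real" where
  "P2 = (2 / sqrt 3, 1 / sqrt 3, -(1 / sqrt 3))"

definition P3 :: "real \<times> real \<times> real" where
  "P3 = (1, 1, 0)"

definition equilateral_triangle :: "real^2 \<Rightarrow> real^2 \<Rightarrow> real^2 \<Rightarrow> bool" where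
  "equilateral_triangle P Q R \<longleftrightarrow> P \<noteq> Q \<and> dist P Q = dist Q R \<and> dist Q R = dist R P"

text \<open>
  Quadrilaterals are given by their vertices in cyclic order. Four equal sides together with
  distinct opposite vertices already exclude the degenerate (flattened) cases.
\<close>

definition rhombus :: "real^2 \<Rightarrow> real^2 \<Rightarrow> real^2 \<Rightarrow> real^2 \<Rightarrow> bool" where
  "rhombus P Q R S \<longleftrightarrow>
     P \<noteq> R \<and> Q \<noteq> S \<and> dist P Q = dist Q R \<and> dist Q R = dist R S \<and> dist R S = dist S P"

definition square :: "real^2 \<Rightarrow> real^2 \<Rightarrow> real^2 \<Rightarrow> real^2 \<Rightarrow> bool" where
  "square P Q R S \<longleftrightarrow>
     rhombus P Q R S \<and> orthogonal (Q - P) (S - P) \<and> orthogonal (P - Q) (R - Q) \<and>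
     orthogonal (Q - R) (S - R) \<and> orthogonal (R - S) (P - S)"

definition angle :: "real^2 \<Rightarrow> real^2 \<Rightarrow> real^2 \<Rightarrow> real" where
  "angle P Q R = arccos (((P - Q) \<bullet> (R - Q)) / (norm (P - Q) * norm (R - Q)))"

text \<open>
  The bases are PQ and SR, the lateral sides QR and SP. A positive factor expresses that the
  bases are parallel and that the closed polygon PQRS is not self-crossing.
\<close>

definition isosceles_trapezoid :: "real^2 \<Rightarrow> real^2 \<Rightarrow> real^2 \<Rightarrow> real^2 \<Rightarrow> bool" where
  "isosceles_trapezoid P Q R S \<longleftrightarrow>
     \<not> collinear {P, Q, R} \<and> (\<exists>t>0. Q - P = t *\<^sub>R (R - S)) \<and>
     dist Q R = dist S P \<and> angle S P Q = angle P Q R \<and> angle Q R S = angle R S P"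

lemma vector_4 [simp]:
  "(vector [w, x, y, z] :: 'a::zero^4) $ 1 = w"
  "(vector [w, x, y, z] :: 'a::zero^4) $ 2 = x"
  "(vector [w, x, y, z] :: 'a::zero^4) $ 3 = y"
  "(vector [w, x, y, z] :: 'a::zero^4) $ 4 = z"
  by (simp_all add: vector_def)

lemma r_explicit:
  "r a b c 2 4 = sqrt (1 + (a - c)\<^sup>2)"
  "r a b c 1 3 = sqrt (1 + b\<^sup>2)"
  "0 \<le> a \<Longrightarrow> r a b c 1 2 = a"
  "r a b c 2 3 = sqrt (1 + (a - b)\<^sup>2)"
  "r a b c 1 4 = sqrt (1 + c\<^sup>2)"
  "c \<le> b \<Longrightarrow> r a b c 3 4 = b - c"
  by (simp_all add: r_def positions_def norm_vec_def L2_set_def sum_2 power2_commute)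

end

theory Submission
  imports Defs
begin

text \<open>
  Let \<open>M\<close> be the total mass, \<open>\<nu> = \<mu> / M\<close> and \<open>s\<^sub>i\<^sub>j = r\<^sub>i\<^sub>j\<^sup>-\<^sup>3 - \<nu>\<close>. Then the equations read
  \<open>\<Sum>\<^sub>j m\<^sub>j s\<^sub>i\<^sub>j (q\<^sub>j - q\<^sub>i) = 0\<close>. For a trapezoid they split into eight proportions between
  products \<open>m\<^sub>j s\<^sub>i\<^sub>j\<close>. With positive masses these force the four sides to have \<open>s > 0\<close>
  and the two diagonals \<open>s < 0\<close> (the opposite signs would make the sides longer than the
  diagonals), together with Dziobek's relations \<open>s\<^sub>1\<^sub>2 s\<^sub>3\<^sub>4 = s\<^sub>1\<^sub>3 s\<^sub>2\<^sub>4 = s\<^sub>1\<^sub>4 s\<^sub>2\<^sub>3\<close>; eliminating \<open>\<nu>\<close> gives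
  \<open>D = 0\<close>, and the last relation gives \<open>r\<^sub>1\<^sub>4 \<ge> r\<^sub>3\<^sub>4\<close>. Conversely the first relation determines a
  \<open>\<nu>\<close> strictly between the inverse cubes of the sides and those of the diagonals, \<open>D = 0\<close> gives
  the second relation, and the masses can be read off.

  On each face of the boundary \<open>D\<close> factors, which leaves equilateral triangles, rhombi and
  isosceles trapezoids. In the last case \<open>f = 0\<close> and \<open>0 < c < 1/\<surd>3\<close> already imply all the
  inequalities on the distances.
\<close>

section \<open>The equations of a central configuration\<close>

text \<open>The pull towards the center of mass becomes a sum over the differences
  \<open>q $ j - q $ k\<close>, which can be merged term by term with the attraction.\<close>

lemma center_of_mass_eq:
  fixes m :: "real^4" and q :: "real^2^4"
  assumes M: "(\<Sum>k\<in>UNIV. m $ k) \<noteq> 0"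
  shows "\<mu> *\<^sub>R (q $ k - center_of_mass m q) =
    - (\<Sum>j\<in>UNIV. (m $ j * (\<mu> / (\<Sum>k\<in>UNIV. m $ k))) *\<^sub>R (q $ j - q $ k))"
proof -
  let ?M = "\<Sum>k\<in>UNIV. m $ k"
  have "(\<Sum>j\<in>UNIV. (m $ j * (\<mu> / ?M)) *\<^sub>R (q $ j - q $ k))
      = (\<mu> / ?M) *\<^sub>R (\<Sum>j\<in>UNIV. m $ j *\<^sub>R (q $ j - q $ k))"
    by (simp add: scaleR_sum_right mult.commute)
  also have "(\<Sum>j\<in>UNIV. m $ j *\<^sub>R (q $ j - q $ k))
      = (\<Sum>j\<in>UNIV. m $ j *\<^sub>R q $ j) - ?M *\<^sub>R q $ k"
    by (simp add: scaleR_diff_right sum_subtractf scaleR_left.sum)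
  finally show ?thesis
    using M by (simp add: center_of_mass_def scaleR_diff_right)
qed

text \<open>With \<open>\<nu> = \<mu> / M\<close>, where \<open>M\<close> is the total mass, the center of mass drops out. Coinciding
  bodies contribute a zero vector, so the same equation covers collisions.\<close>

definition balanced :: "real \<Rightarrow> real^4 \<Rightarrow> real^2^4 \<Rightarrow> bool" where
  "balanced \<nu> m q \<longleftrightarrow>
     (\<forall>k. (\<Sum>j\<in>UNIV. (m $ j * (1 / norm (q $ j - q $ k) ^ 3 - \<nu>)) *\<^sub>R (q $ j - q $ k)) = 0)"

text \<open>The index set \<open>A k\<close> is left open so that both \<open>UNIV - {k}\<close> and
  the set of noncoinciding bodies fit; what it omits contributes zero vectors.\<close>

lemma balanced_iff:
  fixes m :: "real^4" and q :: "real^2^4"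
  assumes M: "(\<Sum>k\<in>UNIV. m $ k) \<noteq> 0"
    and A: "\<And>j k. j \<notin> A k \<Longrightarrow> q $ j = q $ k"
  shows "(\<forall>k. (\<Sum>j\<in>A k. (m $ j / norm (q $ j - q $ k) ^ 3) *\<^sub>R (q $ j - q $ k)) =
          - (\<mu> *\<^sub>R (q $ k - center_of_mass m q)))
    \<longleftrightarrow> balanced (\<mu> / (\<Sum>k\<in>UNIV. m $ k)) m q"
proof -
  let ?M = "\<Sum>k\<in>UNIV. m $ k"
  have "(\<Sum>j\<in>A k. (m $ j / norm (q $ j - q $ k) ^ 3) *\<^sub>R (q $ j - q $ k)) =
      (\<Sum>j\<in>UNIV. (m $ j / norm (q $ j - q $ k) ^ 3) *\<^sub>R (q $ j - q $ k))" for k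
    by (rule sum.mono_neutral_left) (auto dest: A)
  moreover have "(\<Sum>j\<in>UNIV. (m $ j * (1 / norm (q $ j - q $ k) ^ 3 - \<mu> / ?M)) *\<^sub>R (q $ j - q $ k)) =
     (\<Sum>j\<in>UNIV. (m $ j / norm (q $ j - q $ k) ^ 3) *\<^sub>R (q $ j - q $ k)) -
     (\<Sum>j\<in>UNIV. (m $ j * (\<mu> / ?M)) *\<^sub>R (q $ j - q $ k))" for k
    by (simp add: right_diff_distrib scaleR_diff_left sum_subtractf)
  ultimately show ?thesis
    unfolding balanced_def center_of_mass_eq[OF M] by simp
qed

lemma ex_pos_scaled:
  fixes M :: real
  assumes "M > 0"
  shows "(\<exists>\<mu>>0. P (\<mu> / M)) \<longleftrightarrow> (\<exists>\<nu>>0. P \<nu>)"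
proof
  assume "\<exists>\<nu>>0. P \<nu>"
  then obtain \<nu> where "\<nu> > 0" "P \<nu>" by blast
  then show "\<exists>\<mu>>0. P (\<mu> / M)"
    using assms by (intro exI[of _ "\<nu> * M"]) auto
qed (use assms in \<open>auto intro: divide_pos_pos\<close>)

lemma central_configuration_iff_balanced:
  assumes "(\<Sum>k\<in>UNIV. m $ k) > 0"
  shows "central_configuration m q \<longleftrightarrow>
    (\<forall>i j. i \<noteq> j \<longrightarrow> q $ i \<noteq> q $ j) \<and> (\<exists>\<nu>>0. balanced \<nu> m q)"
proof -
  have "(\<forall>k. (\<Sum>j\<in>UNIV - {k}. (m $ j / norm (q $ j - q $ k) ^ 3) *\<^sub>R (q $ j - q $ k)) =
          - (\<mu> *\<^sub>R (q $ k - center_of_mass m q)))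
    \<longleftrightarrow> balanced (\<mu> / (\<Sum>k\<in>UNIV. m $ k)) m q" for \<mu>
    by (rule balanced_iff) (use assms in auto)
  then show ?thesis
    unfolding central_configuration_def using ex_pos_scaled[OF assms, of "\<lambda>\<nu>. balanced \<nu> m q"] by simp
qed

lemma collision_central_configuration_iff_balanced:
  assumes "(\<Sum>k\<in>UNIV. m $ k) > 0"
  shows "collision_central_configuration m q \<longleftrightarrow>
    (\<exists>i j. i \<noteq> j \<and> q $ i = q $ j) \<and> (\<exists>\<nu>>0. balanced \<nu> m q)"
proof -
  have "(\<forall>k. (\<Sum>j\<in>{j. q $ j \<noteq> q $ k}. (m $ j / norm (q $ j - q $ k) ^ 3) *\<^sub>R (q $ j - q $ k)) =
          - (\<mu> *\<^sub>R (q $ k - center_of_mass m q)))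
    \<longleftrightarrow> balanced (\<mu> / (\<Sum>k\<in>UNIV. m $ k)) m q" for \<mu>
    by (rule balanced_iff) (use assms in auto)
  then show ?thesis
    unfolding collision_central_configuration_def
    using ex_pos_scaled[OF assms, of "\<lambda>\<nu>. balanced \<nu> m q"] by simp
qed

section \<open>The equations in the coordinates of the trapezoid\<close>

lemma positions_nth [simp]:
  "positions a b c $ 1 = vector [0, 0]" "positions a b c $ 2 = vector [0, a]"
  "positions a b c $ 3 = vector [1, b]" "positions a b c $ 4 = vector [1, c]"
  by (simp_all add: positions_def)

lemma vector2_eq_iff [simp]: "(vector [x, y] :: real^2) = vector [x', y'] \<longleftrightarrow> x = x' \<and> y = y'"
  by (simp add: vec_eq_iff forall_2)

lemma vector2_diff [simp]: "(vector [x, y] :: real^2) - vector [x', y'] = vector [x - x', y - y']"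
  by (simp add: vec_eq_iff forall_2)

lemma r_commute: "r a b c i j = r a b c j i"
  by (simp add: r_def norm_minus_commute)

text \<open>Bodies 1, 2 share one abscissa and 3, 4 the other, so each first coordinate relates only
  two terms. Inserting it into the second coordinate leaves two terms there as well.\<close>

lemma balanced_positions:
  fixes a b c \<nu> :: real and m :: "real^4"
  defines "s \<equiv> \<lambda>i j. 1 / r a b c i j ^ 3 - \<nu>"
  shows "balanced \<nu> m (positions a b c) \<longleftrightarrow>
    m$3 * s 1 3 = - (m$4 * s 1 4) \<and> a * (m$2 * s 1 2) = - ((b - c) * (m$3 * s 1 3)) \<and>
    m$3 * s 2 3 = - (m$4 * s 2 4) \<and> a * (m$1 * s 1 2) = (b - c) * (m$3 * s 2 3) \<and>
    m$1 * s 1 3 = - (m$2 * s 2 3) \<and> a * (m$2 * s 2 3) = (b - c) * (m$4 * s 3 4) \<and>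
    m$1 * s 1 4 = - (m$2 * s 2 4) \<and> a * (m$2 * s 2 4) = - ((b - c) * (m$3 * s 3 4))"
proof -
  have *: "1 / norm (positions a b c $ j - positions a b c $ k) ^ 3 - \<nu> = s j k" for j k
    by (simp add: s_def r_def)
  have sym: "s 2 1 = s 1 2" "s 3 1 = s 1 3" "s 4 1 = s 1 4" "s 3 2 = s 2 3" "s 4 2 = s 2 4" "s 4 3 = s 3 4"
    by (simp_all add: s_def r_commute)
  define F where "F k = (\<Sum>j\<in>UNIV. (m $ j * s j k) *\<^sub>R (positions a b c $ j - positions a b c $ k))" for k
  have "F 1 = 0 \<longleftrightarrow> m$3 * s 1 3 = - (m$4 * s 1 4) \<and> a * (m$2 * s 1 2) = - ((b - c) * (m$3 * s 1 3))"
    unfolding F_def by (simp add: sum_4 vec_eq_iff forall_2 sym) (safe; algebra)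
  moreover have "F 2 = 0 \<longleftrightarrow> m$3 * s 2 3 = - (m$4 * s 2 4) \<and> a * (m$1 * s 1 2) = (b - c) * (m$3 * s 2 3)"
    unfolding F_def by (simp add: sum_4 vec_eq_iff forall_2 sym) (safe; algebra)
  moreover have "F 3 = 0 \<longleftrightarrow> m$1 * s 1 3 = - (m$2 * s 2 3) \<and> a * (m$2 * s 2 3) = (b - c) * (m$4 * s 3 4)"
    unfolding F_def by (simp add: sum_4 vec_eq_iff forall_2 sym) (safe; algebra)
  moreover have "F 4 = 0 \<longleftrightarrow> m$1 * s 1 4 = - (m$2 * s 2 4) \<and> a * (m$2 * s 2 4) = - ((b - c) * (m$3 * s 3 4))"
    unfolding F_def by (simp add: sum_4 vec_eq_iff forall_2 sym) (safe; algebra)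
  ultimately show ?thesis
    unfolding balanced_def * F_def[symmetric] by (simp only: forall_4 conj_assoc)
qed

text \<open>In the application the \<open>x\<^sub>i\<^sub>j\<close> are the cubed distances, so that the left-hand side is \<open>D\<close>
  and the last factor is the defect in Dziobek's relation \<open>s\<^sub>1\<^sub>2 s\<^sub>3\<^sub>4 = s\<^sub>1\<^sub>4 s\<^sub>2\<^sub>3\<close>.\<close>

lemma cubes_difference_factor:
  fixes x12 x13 x14 x23 x24 x34 \<nu> :: real
  assumes pos: "x12 > 0" "x13 > 0" "x14 > 0" "x23 > 0" "x24 > 0" "x34 > 0"
  defines "s12 \<equiv> 1 / x12 - \<nu>" and "s13 \<equiv> 1 / x13 - \<nu>" and "s14 \<equiv> 1 / x14 - \<nu>"
    and "s23 \<equiv> 1 / x23 - \<nu>" and "s24 \<equiv> 1 / x24 - \<nu>" and "s34 \<equiv> 1 / x34 - \<nu>"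
  assumes P: "s13 * s24 = s12 * s34"
  shows "(x13 - x12) * (x23 - x34) * (x24 - x14) - (x12 - x14) * (x24 - x34) * (x13 - x23) =
    (x12 * x13 * x14 * x23 * x24 * x34) * ((s12 - s13 + s34 - s24) * (s12 * s34 - s14 * s23))"
proof -
  have diff: "x13 - x12 = (s12 - s13) * (x12 * x13)" "x23 - x34 = (s34 - s23) * (x23 * x34)"
    "x24 - x14 = (s14 - s24) * (x14 * x24)" "x12 - x14 = (s14 - s12) * (x12 * x14)"
    "x24 - x34 = (s34 - s24) * (x24 * x34)" "x13 - x23 = (s23 - s13) * (x13 * x23)"
    using pos by (simp_all add: s12_def s13_def s14_def s23_def s24_def s34_def field_simps)
  have "(s12 - s13) * (s34 - s23) * (s14 - s24) - (s14 - s12) * (s34 - s24) * (s23 - s13)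
     = (s12 - s13 + s34 - s24) * (s12 * s34 - s14 * s23)"
    using P by algebra
  then show ?thesis
    unfolding diff by algebra
qed

section \<open>Comparison of the distances and the description of \<open>Omega\<close>\<close>

lemma r_pos:
  assumes "a \<ge> 1" "b > c"
  shows "r a b c 1 2 > 0" "r a b c 1 3 > 0" "r a b c 1 4 > 0"
    "r a b c 2 3 > 0" "r a b c 2 4 > 0" "r a b c 3 4 > 0"
  using assms by (auto simp: r_def simp del: vector2_diff)

text \<open>If both failed, squaring would give \<open>2 * b \<le> a\<close> and
  \<open>a \<le> 2 * c\<close>, against \<open>b > c\<close>. This excludes the reversed sign
  pattern of the \<open>s i j\<close>.\<close>

lemma r_diagonals_gt_lateral_sides:
  assumes "a \<ge> 1" "b > c"
  shows "r a b c 1 3 > r a b c 2 3 \<or> r a b c 2 4 > r a b c 1 4"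
proof (rule ccontr)
  assume "\<not> ?thesis"
  then have "b\<^sup>2 \<le> (a - b)\<^sup>2" "(a - c)\<^sup>2 \<le> c\<^sup>2"
    by (auto simp: r_explicit)
  then have "a * (b - c) \<le> 0"
    by (simp add: power2_eq_square algebra_simps)
  then show False
    using assms by (simp add: mult_le_0_iff)
qed

lemma inverse_cube_le_iff:
  fixes x y :: real
  assumes "x > 0" "y > 0"
  shows "1 / x ^ 3 \<le> 1 / y ^ 3 \<longleftrightarrow> y \<le> x"
proof -
  have "1 / x ^ 3 \<le> 1 / y ^ 3 \<longleftrightarrow> y ^ 3 \<le> x ^ 3"
    using assms by (simp add: field_simps)
  then show ?thesis
    using assms by simp
qed

lemma inverse_cube_less: "0 < x \<Longrightarrow> x < y \<Longrightarrow> 1 / y ^ 3 < 1 / x ^ 3" for x y :: real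
  using inverse_cube_le_iff[of x y] by linarith

lemma positions_distinct:
  assumes "a \<ge> 1" "b \<noteq> c"
  shows "\<forall>i j. i \<noteq> j \<longrightarrow> positions a b c $ i \<noteq> positions a b c $ j"
  using assms by (simp add: forall_4)

lemma sum_masses_pos:
  fixes m :: "real^4"
  assumes "\<forall>i. 0 < m $ i"
  shows "(\<Sum>k\<in>UNIV. m $ k) > 0"
  using assms by (intro sum_pos) auto

lemma realizable_iff_balanced:
  assumes "a \<ge> 1" "b > c"
  shows "realizable a b c \<longleftrightarrow> (\<exists>m \<nu>. (\<forall>i. 0 < m $ i) \<and> 0 < \<nu> \<and> balanced \<nu> m (positions a b c))"
proof -
  have "(\<forall>i. 0 < m $ i) \<and> central_configuration m (positions a b c) \<longleftrightarrow>
      (\<forall>i. 0 < m $ i) \<and> (\<exists>\<nu>>0. balanced \<nu> m (positions a b c))" for m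
    using central_configuration_iff_balanced[OF sum_masses_pos[of m], of "positions a b c"]
      positions_distinct[of a b c] assms by auto
  then show ?thesis
    unfolding realizable_def by blast
qed

lemma realizable_imp_ordered:
  assumes ab: "a \<ge> 1" "b > c" and lab: "labelling_convention a b c" and "realizable a b c"
  shows "D a b c = 0" "r a b c 1 3 > r a b c 1 2" "r a b c 1 4 \<ge> r a b c 3 4"
proof -
  obtain m \<nu> where mpos: "\<And>i. 0 < m $ i" and bal: "balanced \<nu> m (positions a b c)"
    using assms by (auto simp: realizable_iff_balanced)
  note rpos = r_pos[OF ab]
  define s where "s i j = 1 / r a b c i j ^ 3 - \<nu>" for i j
  have a: "a > 0" and d: "b - c > 0" using ab by auto
  have e: "m$3 * s 1 3 = - (m$4 * s 1 4)" "a * (m$2 * s 1 2) = - ((b - c) * (m$3 * s 1 3))"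
    "m$3 * s 2 3 = - (m$4 * s 2 4)" "a * (m$1 * s 1 2) = (b - c) * (m$3 * s 2 3)"
    "m$1 * s 1 3 = - (m$2 * s 2 3)" "a * (m$2 * s 2 3) = (b - c) * (m$4 * s 3 4)"
    "m$1 * s 1 4 = - (m$2 * s 2 4)" "a * (m$2 * s 2 4) = - ((b - c) * (m$3 * s 3 4))"
    using bal unfolding balanced_positions s_def by blast+
  \<comment> \<open>The sign of \<open>s 2 3\<close> decides the others. Were it nonpositive, the
    proportions would give \<open>s 1 3 \<ge> 0\<close>, \<open>s 2 4 \<ge> 0\<close> and
    \<open>s 1 4 \<le> 0\<close>, and neither diagonal would exceed the lateral side it is compared
    with.\<close>
  have s23: "s 2 3 > 0"
  proof (rule ccontr)
    assume "\<not> s 2 3 > 0"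
    then have le: "s 2 3 \<le> 0" by simp
    have "m$2 * s 2 3 \<le> 0" "m$3 * s 2 3 \<le> 0"
      using mpos[of 2] mpos[of 3] le by (simp_all add: mult_nonneg_nonpos)
    then have "m$1 * s 1 3 \<ge> 0" "m$4 * s 2 4 \<ge> 0"
      using e(5) e(3) by linarith+
    then have "s 1 3 \<ge> 0" and s24: "s 2 4 \<ge> 0"
      using mpos by (simp_all add: zero_le_mult_iff not_le[symmetric])
    have "m$1 * s 1 4 \<le> 0"
      using e(7) mpos[of 2] s24 by simp
    then have "s 1 4 \<le> 0"
      using mpos[of 1] by (simp add: mult_le_0_iff)
    with \<open>s 1 3 \<ge> 0\<close> s24 le have "1 / r a b c 2 3 ^ 3 \<le> 1 / r a b c 1 3 ^ 3" "1 / r a b c 1 4 ^ 3 \<le> 1 / r a b c 2 4 ^ 3"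
      by (simp_all add: s_def)
    then have "r a b c 1 3 \<le> r a b c 2 3" "r a b c 2 4 \<le> r a b c 1 4"
      using rpos by (simp_all add: inverse_cube_le_iff)
    then show False
      using r_diagonals_gt_lateral_sides[OF ab] by linarith
  qed
  have "m$1 * s 1 3 < 0" "a * (m$1 * s 1 2) > 0"
    unfolding e(4,5) using mpos s23 d by simp_all
  then have s13: "s 1 3 < 0" and s12: "s 1 2 > 0"
    using mpos[of 1] a by (simp_all add: zero_less_mult_iff mult_less_0_iff not_less[symmetric])
  \<comment> \<open>Cross-multiplying two proportions cancels the masses; the next relation arises
    in the same way.\<close>
  have "s 1 2 * s 3 4 = s 1 3 * s 2 4"
  proof -
    have "(a * (m$2 * s 1 2)) * ((b - c) * (m$3 * s 3 4)) = ((b - c) * (m$3 * s 1 3)) * (a * (m$2 * s 2 4))"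
      using e(2) e(8) by simp
    then have "(a * m$2 * (b - c) * m$3) * (s 1 2 * s 3 4) = (a * m$2 * (b - c) * m$3) * (s 1 3 * s 2 4)"
      by (simp add: mult_ac)
    then show ?thesis
      using a d mpos[of 2] mpos[of 3] by simp
  qed
  moreover have "s 1 4 * s 2 3 = s 1 3 * s 2 4"
  proof -
    have "(m$4 * s 1 4) * (m$3 * s 2 3) = (m$3 * s 1 3) * (m$4 * s 2 4)"
      using e(1) e(3) by simp
    then have "(m$3 * m$4) * (s 1 4 * s 2 3) = (m$3 * m$4) * (s 1 3 * s 2 4)"
      by (simp add: mult_ac)
    then show ?thesis
      using mpos[of 3] mpos[of 4] by simp
  qed
  ultimately have P: "s 1 2 * s 3 4 = s 1 4 * s 2 3" "s 1 3 * s 2 4 = s 1 2 * s 3 4"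
    by simp_all
  show "D a b c = 0"
    unfolding D_def
    by (subst cubes_difference_factor[where \<nu> = \<nu>])
      (use rpos P in \<open>simp_all add: s_def[symmetric]\<close>)
  have "1 / r a b c 1 3 ^ 3 < 1 / r a b c 1 2 ^ 3"
    using s12 s13 by (simp add: s_def)
  then show "r a b c 1 3 > r a b c 1 2"
    using rpos by (simp add: inverse_cube_le_iff not_le[symmetric])
  have "r a b c 2 3 \<le> r a b c 1 2" "r a b c 1 4 \<le> r a b c 2 3"
    using lab by (auto simp: labelling_convention_def)
  \<comment> \<open>Given \<open>s 1 2 \<le> s 2 3\<close>, the relation
    \<open>s 1 2 * s 3 4 = s 1 4 * s 2 3\<close> needs \<open>s 3 4\<close> to be at least
    \<open>s 1 4\<close>.\<close>
  then have "s 1 2 \<le> s 2 3" "s 2 3 \<le> s 1 4"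
    using rpos by (simp_all add: s_def inverse_cube_le_iff)
  then have "s 1 2 * s 1 4 \<le> s 1 2 * s 3 4"
    using P(1) s12 by (simp add: mult.commute mult_left_mono)
  then have "s 1 4 \<le> s 3 4"
    using s12 by simp
  then show "r a b c 1 4 \<ge> r a b c 3 4"
    using rpos by (simp add: s_def inverse_cube_le_iff)
qed

lemma ordered_imp_realizable:
  assumes ab: "a \<ge> 1" "b > c" and D: "D a b c = 0"
    and ord: "r a b c 2 4 \<ge> r a b c 1 3" "r a b c 1 3 > r a b c 1 2" "r a b c 1 2 \<ge> r a b c 2 3"
      "r a b c 2 3 \<ge> r a b c 1 4" "r a b c 1 4 \<ge> r a b c 3 4"
  shows "realizable a b c"
proof -
  note rpos = r_pos[OF ab]
  define y where "y i j = 1 / r a b c i j ^ 3" for i j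
  \<comment> \<open>\<open>\<nu>\<close> is the solution of \<open>s\<^sub>1\<^sub>2 s\<^sub>3\<^sub>4 = s\<^sub>1\<^sub>3 s\<^sub>2\<^sub>4\<close>, which is linear in \<open>\<nu>\<close>.\<close>
  define e where "e = y 1 2 + y 3 4 - y 1 3 - y 2 4"
  define \<nu> where "\<nu> = (y 1 2 * y 3 4 - y 1 3 * y 2 4) / e"
  define s where "s i j = y i j - \<nu>" for i j
  have ypos: "y 1 3 > 0" "y 2 4 > 0"
    using rpos by (simp_all add: y_def)
  have yord: "y 2 4 \<le> y 1 3" "y 1 3 < y 1 2" "y 1 2 \<le> y 2 3" "y 2 3 \<le> y 1 4" "y 1 4 \<le> y 3 4"
    using ord rpos by (simp_all add: y_def inverse_cube_le_iff not_le[symmetric])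
  then have epos: "e > 0" by (simp add: e_def)
  have "y 1 3 * y 2 4 < y 1 2 * y 3 4"
    using yord ypos by (intro mult_strict_mono) auto
  then have \<nu>pos: "\<nu> > 0"
    using epos by (simp add: \<nu>_def)
  have \<nu>e: "\<nu> * e = y 1 2 * y 3 4 - y 1 3 * y 2 4"
    using epos by (simp add: \<nu>_def)
  \<comment> \<open>After multiplication by \<open>e\<close> the differences factor, which places
    \<open>\<nu>\<close> strictly below \<open>y 1 2\<close> and strictly above \<open>y 1 3\<close>
    and \<open>y 2 4\<close>.\<close>
  have "s 1 2 * e = (y 1 2 - y 1 3) * (y 1 2 - y 2 4)" "s 1 3 * e = - ((y 1 2 - y 1 3) * (y 3 4 - y 1 3))"
    "s 2 4 * e = - ((y 1 2 - y 2 4) * (y 3 4 - y 2 4))"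
    using \<nu>e unfolding s_def e_def by algebra+
  moreover have "(y 1 2 - y 1 3) * (y 1 2 - y 2 4) > 0" "(y 1 2 - y 1 3) * (y 3 4 - y 1 3) > 0"
     "(y 1 2 - y 2 4) * (y 3 4 - y 2 4) > 0"
    using yord by (auto intro!: mult_pos_pos)
  ultimately have "s 1 2 * e > 0" "s 1 3 * e < 0" "s 2 4 * e < 0"
    by simp_all
  then have s12: "s 1 2 > 0" and s13: "s 1 3 < 0" and s24: "s 2 4 < 0"
    using epos by (simp_all add: zero_less_mult_iff mult_less_0_iff)
  have s14: "s 1 4 > 0" and s23: "s 2 3 > 0" and s34: "s 3 4 > 0"
    using s12 yord by (simp_all add: s_def)
  have P: "s 1 3 * s 2 4 = s 1 2 * s 3 4"
    using \<nu>e unfolding s_def e_def by algebra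
  have "D a b c = (r a b c 1 2 ^ 3 * r a b c 1 3 ^ 3 * r a b c 1 4 ^ 3 * r a b c 2 3 ^ 3 * r a b c 2 4 ^ 3 * r a b c 3 4 ^ 3)
    * ((s 1 2 - s 1 3 + s 3 4 - s 2 4) * (s 1 2 * s 3 4 - s 1 4 * s 2 3))"
    unfolding D_def s_def y_def
    by (rule cubes_difference_factor) (use rpos P in \<open>simp_all add: s_def y_def\<close>)
  \<comment> \<open>With this cofactor positive, \<open>D = 0\<close> is equivalent to the remaining
    Dziobek relation.\<close>
  moreover have "s 1 2 - s 1 3 + s 3 4 - s 2 4 > 0"
    using s12 s13 s34 s24 by linarith
  ultimately have Q: "s 1 4 * s 2 3 = s 1 2 * s 3 4"
    using D rpos by simp
  define d where "d = b - c"
  have a: "a > 0" and d: "d > 0" using ab by (auto simp: d_def)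
  \<comment> \<open>Normalised by \<open>m$2 = 1\<close>: \<open>m$1\<close> comes from the
    proportion between \<open>s 1 3\<close> and \<open>s 2 3\<close>, \<open>m$3\<close> from the
    one between \<open>s 1 2\<close> and \<open>s 1 3\<close>, then \<open>m$4\<close> from the one
    between \<open>s 1 3\<close> and \<open>s 1 4\<close>.\<close>
  define m :: "real^4" where
    "m = vector [- s 2 3 / s 1 3, 1, - (a * s 1 2) / (d * s 1 3), a * s 1 2 / (d * s 1 4)]"
  have "\<forall>i. 0 < m $ i"
    using s12 s13 s14 s23 a d
    by (simp add: forall_4 m_def zero_less_divide_iff divide_less_0_iff mult_less_0_iff)
  moreover have "balanced \<nu> m (positions a b c)"
    unfolding balanced_positions y_def[symmetric] s_def[symmetric] d_def[symmetric]
    using s12 s13 s14 s23 s24 s34 a d P Q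
    by (simp add: m_def field_simps)
  ultimately show ?thesis
    using \<nu>pos realizable_iff_balanced[OF ab] by blast
qed

text \<open>The chain of inequalities already contains the labelling convention.\<close>

lemma Omega_eq:
  "Omega = {(a, b, c). a \<ge> 1 \<and> b > c \<and> D a b c = 0 \<and>
         r a b c 2 4 \<ge> r a b c 1 3 \<and> r a b c 1 3 > r a b c 1 2 \<and> r a b c 1 2 \<ge> r a b c 2 3 \<and>
         r a b c 2 3 \<ge> r a b c 1 4 \<and> r a b c 1 4 \<ge> r a b c 3 4}"
  unfolding Omega_def
  by (auto simp: realizable_imp_ordered ordered_imp_realizable)
    (auto simp: labelling_convention_def)

section \<open>Trapezoids with equal lateral sides\<close>

lemma powr_three_halves: "x > 0 \<Longrightarrow> x powr (3/2) = sqrt x ^ 3" for x :: real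
  by (simp add: powr_half_sqrt[symmetric] powr_power)

lemma f_eq:
  "f b c = ((b + c) ^ 3 - sqrt (1 + c\<^sup>2) ^ 3) * (sqrt (1 + b\<^sup>2) ^ 3 - (b - c) ^ 3)
     - (sqrt (1 + b\<^sup>2) ^ 3 - (b + c) ^ 3) * (sqrt (1 + c\<^sup>2) ^ 3 - (b - c) ^ 3)"
proof -
  have "x\<^sup>2 + 1 > 0" for x :: real
    by (rule add_nonneg_pos) auto
  then show ?thesis
    by (simp add: f_def powr_three_halves add.commute)
qed

text \<open>For \<open>a = b + c\<close> the diagonals agree and so do the lateral sides, so the two
  products in \<open>D\<close> share a factor; \<open>f\<close> is, up to sign, what
  remains.\<close>

lemma D_isosceles:
  assumes "b + c \<ge> 0" "b \<ge> c"
  shows "D (b + c) b c = - ((sqrt (1 + b\<^sup>2) ^ 3 - sqrt (1 + c\<^sup>2) ^ 3) * f b c)"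
  using assms by (simp add: D_def r_explicit f_eq algebra_simps)

lemma cube_eq_iff: "x \<ge> 0 \<Longrightarrow> y \<ge> 0 \<Longrightarrow> x ^ 3 = y ^ 3 \<longleftrightarrow> x = y" for x y :: real
  by (simp add: power_eq_iff_eq_base)

text \<open>Cubing preserves order on the whole line; below, this is applied while
  \<open>b - c\<close> may still be negative.\<close>

lemma cube_less_iff: "x ^ 3 < y ^ 3 \<longleftrightarrow> x < y" for x y :: real
  using real_root_less_iff[of 3 "x ^ 3" "y ^ 3"] by (simp add: odd_real_root_power_cancel)

text \<open>This rules out \<open>f b c = 0\<close> with \<open>b - c \<ge> sqrt (1 + c\<^sup>2)\<close>. The two squared binomials in the
  proof express the convexity of \<open>x powr (3/2)\<close> at \<open>s\<^sup>2\<close> and at \<open>d\<^sup>2\<close>.\<close>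

lemma cubes_product_less:
  fixes s b d c :: real
  assumes "0 < d" "d < s" "0 \<le> c" "c \<le> d" "0 \<le> b" "b \<le> s" and sq: "s\<^sup>2 - b\<^sup>2 < b\<^sup>2 - d\<^sup>2"
  shows "(s ^ 3 - b ^ 3) * (d ^ 3 - c ^ 3) < (s ^ 3 - c ^ 3) * (b ^ 3 - d ^ 3)"
proof -
  have "(s - b)\<^sup>2 * (s + 2 * b) \<ge> 0" "(b - d)\<^sup>2 * (2 * b + d) \<ge> 0"
    using assms by auto
  then have "s ^ 3 - b ^ 3 \<le> 3 / 2 * (s * (s\<^sup>2 - b\<^sup>2))" "3 / 2 * (d * (b\<^sup>2 - d\<^sup>2)) \<le> b ^ 3 - d ^ 3"
    by (simp_all add: power2_eq_square power3_eq_cube algebra_simps)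
  then have "(s ^ 3 - b ^ 3) * d \<le> 3 / 2 * (s * (s\<^sup>2 - b\<^sup>2)) * d"
     "3 / 2 * (d * (b\<^sup>2 - d\<^sup>2)) * s \<le> (b ^ 3 - d ^ 3) * s"
    using assms by (auto intro!: mult_right_mono simp del: times_divide_eq_left)
  moreover have "3 / 2 * (s * (s\<^sup>2 - b\<^sup>2)) * d < 3 / 2 * (d * (b\<^sup>2 - d\<^sup>2)) * s"
    using assms mult_strict_left_mono[OF sq, of "s * d"] by (simp add: mult_ac)
  ultimately have 1: "(s ^ 3 - b ^ 3) * d < (b ^ 3 - d ^ 3) * s"
    by linarith
  have "0 < s * d * (s\<^sup>2 - d\<^sup>2) + c ^ 3 * (s - d)"
    using assms by (intro add_pos_nonneg mult_pos_pos) (auto simp: power_strict_mono)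
  then have 2: "(d ^ 3 - c ^ 3) * s < (s ^ 3 - c ^ 3) * d"
    by (simp add: power2_eq_square power3_eq_cube algebra_simps)
  \<comment> \<open>In quotient form, 1 and 2 bound \<open>(s ^ 3 - b ^ 3) / (b ^ 3 - d ^ 3)\<close>
    by \<open>s / d\<close> and \<open>(d ^ 3 - c ^ 3) / (s ^ 3 - c ^ 3)\<close> by
    \<open>d / s\<close>; these two bounds multiply to 1.\<close>
  have "((s ^ 3 - b ^ 3) * d) * ((d ^ 3 - c ^ 3) * s) < ((b ^ 3 - d ^ 3) * s) * ((s ^ 3 - c ^ 3) * d)"
    by (rule mult_strict_mono[OF 1 2])
      (use assms 1 2 in \<open>auto intro: le_less_trans[rotated] mult_nonneg_nonneg power_mono\<close>)
  then have "(s * d) * ((s ^ 3 - b ^ 3) * (d ^ 3 - c ^ 3)) < (s * d) * ((s ^ 3 - c ^ 3) * (b ^ 3 - d ^ 3))"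
    by (simp only: mult_ac)
  then show ?thesis
    using assms by (simp add: mult_less_cancel_left_pos)
qed

text \<open>\<open>f b c = 0\<close> equates two products, so the signs of their factors can be
  compared. Once \<open>b - c < C\<close> is known, \<open>b + c\<close> lies between
  \<open>B\<close> and \<open>C\<close> or equals both, and \<open>C < B\<close> settles the
  order.\<close>

lemma f_zero_ordered:
  fixes b c :: real
  assumes f0: "f b c = 0" and c: "0 < c" "3 * c\<^sup>2 < 1"
  defines "B \<equiv> sqrt (1 + b\<^sup>2)" and "C \<equiv> sqrt (1 + c\<^sup>2)"
  shows "b > c \<and> b - c < C \<and> C < b + c \<and> b + c < B"
proof -
  have BC: "B > 0" "C > 0" "B\<^sup>2 = 1 + b\<^sup>2" "C\<^sup>2 = 1 + c\<^sup>2"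
    by (auto simp: B_def C_def add_pos_nonneg)
  have f0: "((b + c) ^ 3 - C ^ 3) * (B ^ 3 - (b - c) ^ 3) = (B ^ 3 - (b + c) ^ 3) * (C ^ 3 - (b - c) ^ 3)"
    using f0 by (simp add: f_eq B_def C_def)
  have Bb: "b < B"
    unfolding B_def by (rule real_less_rsqrt) simp
  then have BD: "B ^ 3 - (b - c) ^ 3 > 0"
    using c by (simp add: cube_less_iff)
  have same_sign: "(b + c < C \<and> B < b + c) \<or> (C < b + c \<and> b + c < B) \<or> (b + c = C \<and> b + c = B)"
    if "C ^ 3 - (b - c) ^ 3 > 0"
  proof -
    have "b + c < C \<longleftrightarrow> ((b + c) ^ 3 - C ^ 3) * (B ^ 3 - (b - c) ^ 3) < 0"
      "C < b + c \<longleftrightarrow> ((b + c) ^ 3 - C ^ 3) * (B ^ 3 - (b - c) ^ 3) > 0"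
      using BD by (auto simp: mult_less_0_iff zero_less_mult_iff cube_less_iff)
    moreover have "B < b + c \<longleftrightarrow> (B ^ 3 - (b + c) ^ 3) * (C ^ 3 - (b - c) ^ 3) < 0"
      "b + c < B \<longleftrightarrow> (B ^ 3 - (b + c) ^ 3) * (C ^ 3 - (b - c) ^ 3) > 0"
      using that by (auto simp: mult_less_0_iff zero_less_mult_iff cube_less_iff)
    ultimately show ?thesis
      unfolding f0 by linarith
  qed
  \<comment> \<open>For \<open>b \<le> c\<close> one has \<open>b + c \<le> 2 * c < C\<close>, which
    forces \<open>B < b + c\<close>; but
    \<open>(b + c)\<^sup>2 \<le> b\<^sup>2 + 3 * c\<^sup>2 < B\<^sup>2\<close>.\<close>
  have bc: "b > c"
  proof (rule ccontr)
    assume "\<not> b > c"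
    then have le: "b \<le> c" by simp
    then have "C ^ 3 - (b - c) ^ 3 > 0"
      using BC by (simp add: cube_less_iff)
    moreover have "(2 * c)\<^sup>2 < C\<^sup>2"
      using c BC by (simp add: power2_eq_square)
    then have "2 * c < C"
      using BC by (auto intro: power2_less_imp_less)
    ultimately have "B < b + c"
      using same_sign le by linarith
    then have "B\<^sup>2 < (b + c)\<^sup>2"
      using BC(1) by (intro power_strict_mono) auto
    moreover have "b * c \<le> c\<^sup>2"
      using le c by (simp add: power2_eq_square)
    ultimately show False
      using c BC(3) unfolding power2_sum by linarith
  qed
  \<comment> \<open>Otherwise both products are positive, so
    \<open>C \<le> b - c < B < b + c\<close>, and \<open>cubes_product_less\<close> makes them
    unequal.\<close>
  have DC: "b - c < C"
  proof (rule ccontr)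
    assume "\<not> b - c < C"
    then have le: "C \<le> b - c" by simp
    have "((b + c) ^ 3 - C ^ 3) * (B ^ 3 - (b - c) ^ 3) > 0"
      using BD le c by (simp add: cube_less_iff)
    then have "(B ^ 3 - (b + c) ^ 3) * (C ^ 3 - (b - c) ^ 3) > 0"
      by (simp add: f0)
    then have "B < b + c"
      using le by (auto simp: zero_less_mult_iff cube_less_iff)
    moreover have "c\<^sup>2 < 1" using c by linarith
    then have "(b + c)\<^sup>2 - B\<^sup>2 < B\<^sup>2 - (b - c)\<^sup>2"
      using BC by (simp add: power2_eq_square algebra_simps)
    ultimately have "((b + c) ^ 3 - B ^ 3) * ((b - c) ^ 3 - C ^ 3) < ((b + c) ^ 3 - C ^ 3) * (B ^ 3 - (b - c) ^ 3)"
      using bc c BC le by (intro cubes_product_less) auto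
    then show False
      unfolding f0 by (simp add: algebra_simps)
  qed
  moreover have "C < B"
    using bc c by (simp add: B_def C_def power_strict_mono)
  moreover have "C ^ 3 - (b - c) ^ 3 > 0"
    using DC by (simp add: cube_less_iff)
  ultimately show ?thesis
    using bc same_sign by linarith
qed

section \<open>The boundary\<close>

lemma inverse_sqrt3:
  defines "t \<equiv> 1 / sqrt 3"
  shows "t > 0" "3 * t\<^sup>2 = 1" "2 / sqrt 3 = 2 * t" "sqrt (1 + t\<^sup>2) = 2 * t"
proof -
  show t: "t > 0" "3 * t\<^sup>2 = 1" "2 / sqrt 3 = 2 * t"
    by (simp_all add: t_def power_divide)
  then show "sqrt (1 + t\<^sup>2) = 2 * t"
    by (intro real_sqrt_unique) (auto simp: power_mult_distrib)
qed

text \<open>The conditions of \<open>boundary_Omega\<close> without the required equality, so that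
  they serve both the boundary and realizability.\<close>

definition ordered_D0 :: "real \<Rightarrow> real \<Rightarrow> real \<Rightarrow> bool" where
  "ordered_D0 a b c \<longleftrightarrow> a \<ge> 1 \<and> b \<ge> c \<and> D a b c = 0 \<and>
        r a b c 2 4 \<ge> r a b c 1 3 \<and> r a b c 1 3 \<ge> r a b c 1 2 \<and> r a b c 1 2 \<ge> r a b c 2 3 \<and>
        r a b c 2 3 \<ge> r a b c 1 4 \<and> r a b c 1 4 \<ge> r a b c 3 4"

lemma ordered_D0_realizable:
  "ordered_D0 a b c \<Longrightarrow> b > c \<Longrightarrow> r a b c 1 3 > r a b c 1 2 \<Longrightarrow> realizable a b c"
  unfolding ordered_D0_def by (intro ordered_imp_realizable) auto

section \<open>Families that satisfy the boundary conditions\<close>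

lemma equilateral_r:
  fixes c :: real
  defines "t \<equiv> 1 / sqrt 3"
  assumes c: "- t \<le> c" "c \<le> t"
  shows "r (2 * t) t c 1 2 = 2 * t" "r (2 * t) t c 1 3 = 2 * t" "r (2 * t) t c 2 3 = 2 * t"
    "r (2 * t) t c 1 4 = sqrt (1 + c\<^sup>2)" "r (2 * t) t c 2 4 = sqrt (1 + (2 * t - c)\<^sup>2)"
    "r (2 * t) t c 3 4 = t - c"
    using c inverse_sqrt3 by (simp_all add: r_explicit t_def[symmetric])

text \<open>Three equal distances make a factor vanish in each product of \<open>D\<close>. The
  endpoints are included because they give \<open>P1\<close> and \<open>P2\<close>.\<close>

lemma equilateral_ordered:
  fixes c :: real
  defines "t \<equiv> 1 / sqrt 3"
  assumes c: "- t \<le> c" "c \<le> t"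
  shows "ordered_D0 (2 * t) t c"
proof -
  note t = inverse_sqrt3[folded t_def]
  note r = equilateral_r[of c, folded t_def, OF c]
  have "c\<^sup>2 \<le> t\<^sup>2"
    using c abs_le_square_iff[of c t] by auto
  then have "sqrt (1 + c\<^sup>2) \<le> 2 * t"
    using t(4) by (metis add_left_mono real_sqrt_le_iff)
  moreover have "t\<^sup>2 \<le> (2 * t - c)\<^sup>2"
    using c t by (intro power_mono) auto
  then have "2 * t \<le> sqrt (1 + (2 * t - c)\<^sup>2)"
    using t(4) by (metis add_left_mono real_sqrt_le_iff)
  moreover have "t - c \<le> sqrt (1 + c\<^sup>2)"
  proof (rule real_le_rsqrt)
    have "- (c * t) \<le> t * t"
      using c t mult_right_mono[of "- t" c t] by simp
    then show "(t - c)\<^sup>2 \<le> 1 + c\<^sup>2"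
      using t by (simp add: power2_eq_square algebra_simps)
  qed
  moreover have "2 * t \<ge> 1"
    using t(4) real_sqrt_ge_1_iff[of "1 + t\<^sup>2"] by simp
  ultimately show ?thesis
    unfolding ordered_D0_def r D_def using c by simp
qed

lemma rhombus_r:
  fixes c :: real
  defines "a \<equiv> sqrt (1 + c\<^sup>2)"
  shows "r a (c + a) c 1 2 = a" "r a (c + a) c 2 3 = a" "r a (c + a) c 3 4 = a"
    "r a (c + a) c 1 4 = a"
  by (simp_all add: r_explicit a_def)

text \<open>Equal sides annihilate both products of \<open>D\<close>. The bound
  \<open>- (2 * c) \<le> a\<close> says that the shorter diagonal is no shorter than a side.\<close>

lemma rhombus_ordered:
  fixes c :: real
  assumes c: "c \<le> 0"
  defines "a \<equiv> sqrt (1 + c\<^sup>2)"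
  assumes d: "- (2 * c) \<le> a"
  shows "ordered_D0 a (c + a) c"
proof -
  note r = rhombus_r[of c, folded a_def]
  have "(c + a)\<^sup>2 \<le> (a - c)\<^sup>2"
    using c d by (intro power_mono) auto
  then have "r a (c + a) c 1 3 \<le> r a (c + a) c 2 4"
    by (simp add: r_explicit)
  moreover have "(- c)\<^sup>2 \<le> (c + a)\<^sup>2"
    using c d by (intro power_mono) auto
  then have "a \<le> r a (c + a) c 1 3"
    by (simp add: r_explicit a_def)
  moreover have "a \<ge> 1" by (simp add: a_def)
  ultimately show ?thesis
    unfolding ordered_D0_def by (simp add: r D_def)
qed

lemma rhombus_strict:
  fixes c :: real
  assumes c: "c \<le> 0"
  defines "a \<equiv> sqrt (1 + c\<^sup>2)"
  assumes d: "- (2 * c) < a"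
  shows "r a (c + a) c 1 3 > r a (c + a) c 1 2"
proof -
  have "(- c)\<^sup>2 < (c + a)\<^sup>2"
    using c d by (intro power_strict_mono) auto
  then have "a < r a (c + a) c 1 3"
    by (simp add: r_explicit a_def)
  then show ?thesis
    by (simp add: rhombus_r[of c, folded a_def])
qed

lemma isosceles_ordered:
  assumes "f b c = 0" "0 < c" "3 * c\<^sup>2 < 1"
  shows "ordered_D0 (b + c) b c \<and> b > c \<and> r (b + c) b c 1 2 < r (b + c) b c 1 3 \<and>
     r (b + c) b c 2 4 = r (b + c) b c 1 3 \<and> r (b + c) b c 2 3 = r (b + c) b c 1 4"
proof -
  note o = f_zero_ordered[OF assms]
  have "1 \<le> sqrt (1 + c\<^sup>2)" by simp
  then have "b + c \<ge> 1" using o by linarith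
  moreover from this o have "D (b + c) b c = 0"
    using assms by (simp add: D_isosceles)
  ultimately show ?thesis
    using o assms by (auto simp: ordered_D0_def r_explicit intro!: power_mono)
qed

section \<open>The equality cases of the boundary\<close>

lemma eq_inverse_sqrt3_iff:
  assumes "x \<ge> 0"
  shows "x = 1 / sqrt 3 \<longleftrightarrow> 3 * x\<^sup>2 = 1" "x < 1 / sqrt 3 \<longleftrightarrow> 3 * x\<^sup>2 < 1"
proof -
  define t :: real where "t = 1 / sqrt 3"
  have t: "t > 0" "3 * t\<^sup>2 = 1"
    using inverse_sqrt3 by (simp_all add: t_def)
  have "x = t \<longleftrightarrow> x\<^sup>2 = t\<^sup>2"
    using t assms by (simp add: power2_eq_iff_nonneg)
  then show "x = 1 / sqrt 3 \<longleftrightarrow> 3 * x\<^sup>2 = 1"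
    unfolding t_def[symmetric] using t by linarith
  have "x < t \<longleftrightarrow> x\<^sup>2 < t\<^sup>2"
    using t assms by (metis abs_of_nonneg abs_square_less_1 power2_less_imp_less power_strict_mono zero_less_numeral less_imp_le)
  then show "x < 1 / sqrt 3 \<longleftrightarrow> 3 * x\<^sup>2 < 1"
    unfolding t_def[symmetric] using t by linarith
qed

text \<open>The squared chain gives \<open>2 * (b * c) + c\<^sup>2 \<le> 1\<close>, hence
  \<open>3 * c\<^sup>2 \<le> 1\<close> by \<open>c \<le> b\<close>. The extreme values of
  \<open>c\<close> are the square and the collision; in between \<open>b \<noteq> c\<close>, so the
  cofactor of \<open>f\<close> in \<open>D_isosceles\<close> is nonzero.\<close>

lemma ordered_isosceles_cases:
  assumes o: "ordered_D0 (b + c) b c"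
  shows "(b + c, b, c) \<in> C3 \<union> {P1} \<union> {P3}"
proof -
  have ab: "b + c \<ge> 1" "b \<ge> c" and D0: "D (b + c) b c = 0"
    and ch: "b + c \<le> sqrt (1 + b\<^sup>2)" "sqrt (1 + c\<^sup>2) \<le> b + c" "b - c \<le> sqrt (1 + c\<^sup>2)"
    using o by (auto simp: ordered_D0_def r_explicit)
  have sq: "(b + c)\<^sup>2 \<le> 1 + b\<^sup>2" "1 + c\<^sup>2 \<le> (b + c)\<^sup>2"
    using ab ch power_mono[OF ch(1), of 2] power_mono[OF ch(2), of 2] by auto
  have c0: "c \<ge> 0" using ch by linarith
  show ?thesis
  proof (cases "c = 0")
    case True
    then have "b = 1" using ch ab by auto
    with True show ?thesis by (simp add: P3_def)
  next
    case False
    with c0 have c: "c > 0" by simp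
    have le: "2 * (b * c) + c\<^sup>2 \<le> 1"
      using sq by (simp add: power2_eq_square algebra_simps)
    have bc: "c * c \<le> b * c"
      using ab c by simp
    show ?thesis
    proof (cases "3 * c\<^sup>2 = 1")
      case True
      then have "b * c \<le> c * c"
        using le by (simp add: power2_eq_square)
      then have "b = c"
        using c ab by simp
      moreover have "c = 1 / sqrt 3"
        using True c by (simp add: eq_inverse_sqrt3_iff)
      ultimately show ?thesis
        by (simp add: P1_def)
    next
      case False
      then have c3: "3 * c\<^sup>2 < 1"
        using le bc by (simp add: power2_eq_square)
      have "b \<noteq> c"
        using sq c3 by (auto simp: power2_eq_square algebra_simps)
      then have "c\<^sup>2 < b\<^sup>2"
        using ab c by (intro power_strict_mono) auto
      then have "sqrt (1 + b\<^sup>2) ^ 3 \<noteq> sqrt (1 + c\<^sup>2) ^ 3"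
        by (simp add: cube_eq_iff)
      then have "f b c = 0"
        using D0 ab by (simp add: D_isosceles)
      then show ?thesis
        using c c3 by (simp add: C3_def eq_inverse_sqrt3_iff)
    qed
  qed
qed

text \<open>The bases are equal and bound the lateral sides from both ends of the chain, so the
  parallelogram is a rhombus.\<close>

lemma ordered_parallelogram_cases:
  assumes o: "ordered_D0 a (c + a) c"
  shows "(a, c + a, c) \<in> C2 \<union> {P2} \<union> {P3}"
proof -
  have a1: "a \<ge> 1" and a: "a = sqrt (1 + c\<^sup>2)" and "c\<^sup>2 \<le> (c + a)\<^sup>2" "(c + a)\<^sup>2 \<le> (a - c)\<^sup>2"
    using o by (auto simp: ordered_D0_def r_explicit)
  then have "0 \<le> a * (2 * c + a)" "a * c \<le> 0"
    by (simp_all add: power2_eq_square algebra_simps)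
  then have c: "c \<le> 0" "- (2 * c) \<le> a"
    using a1 by (auto simp: zero_le_mult_iff mult_le_0_iff)
  have a2: "a\<^sup>2 = 1 + c\<^sup>2" using a by simp
  have "(- (2 * c))\<^sup>2 \<le> a\<^sup>2"
    using c by (intro power_mono) auto
  then have c3: "3 * (- c)\<^sup>2 \<le> 1"
    using a2 by simp
  show ?thesis
  proof (cases "c = 0 \<or> 3 * (- c)\<^sup>2 = 1")
    case True
    then show ?thesis
    proof
      assume "c = 0"
      then show ?thesis using a by (simp add: P3_def)
    next
      assume e: "3 * (- c)\<^sup>2 = 1"
      then have c': "- c = 1 / sqrt 3"
        using c eq_inverse_sqrt3_iff(1)[of "- c"] by simp
      moreover have "a = 2 * (1 / sqrt 3)"
        using inverse_sqrt3(4) c' a by (metis power2_minus)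
      ultimately show ?thesis
        by (simp add: P2_def)
    qed
  next
    case False
    then have "- c < 1 / sqrt 3" "c < 0"
      using c c3 eq_inverse_sqrt3_iff(2)[of "- c"] by auto
    then have "(a, c + a, c) \<in> C2"
      unfolding C2_def using a by (intro CollectI exI[of _ c]) auto
    then show ?thesis by simp
  qed
qed

lemma ordered_lateral_equal_cases:
  assumes o: "ordered_D0 a b c" and eq: "r a b c 2 3 = r a b c 1 4"
  shows "(a, b, c) \<in> C2 \<union> C3 \<union> {P1} \<union> {P2} \<union> {P3}"
proof -
  have "(a - b)\<^sup>2 = c\<^sup>2"
    using eq by (simp add: r_explicit)
  then consider "a = b + c" | "b = c + a"
    by (auto simp: power2_eq_iff)
  then show ?thesis
    using o ordered_isosceles_cases[of b c] ordered_parallelogram_cases[of a c] by cases auto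
qed

lemma ordered_boundary_cases:
  assumes o: "ordered_D0 a b c"
    and "r a b c 2 4 = r a b c 1 3 \<or> r a b c 1 3 = r a b c 1 2 \<or> r a b c 1 2 = r a b c 2 3 \<or>
         r a b c 2 3 = r a b c 1 4 \<or> r a b c 1 4 = r a b c 3 4"
  shows "(a, b, c) \<in> C1 \<union> C2 \<union> C3 \<union> {P1} \<union> {P2} \<union> {P3}"
proof -
  note lateral = ordered_lateral_equal_cases[OF o]
  have ab: "a \<ge> 1" "b \<ge> c" and D0: "D a b c = 0"
    and ch: "r a b c 2 4 \<ge> r a b c 1 3" "r a b c 1 3 \<ge> r a b c 1 2" "r a b c 1 2 \<ge> r a b c 2 3"
        "r a b c 2 3 \<ge> r a b c 1 4" "r a b c 1 4 \<ge> r a b c 3 4"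
    using o by (auto simp: ordered_D0_def)
  have cube: "r a b c i j ^ 3 = r a b c k l ^ 3 \<longleftrightarrow> r a b c i j = r a b c k l" for i j k l
    by (intro cube_eq_iff) (simp_all add: r_def)
  have diagonals: ?thesis if "r a b c 2 4 = r a b c 1 3"
  proof -
    have "(a - c)\<^sup>2 = b\<^sup>2"
      using that by (simp add: r_explicit)
    then have "a = b + c"
      using ab by (auto simp: power2_eq_iff)
    then have "r a b c 2 3 = r a b c 1 4"
      by (simp add: r_explicit)
    then show ?thesis using lateral by auto
  qed
  have triangle: ?thesis if e: "r a b c 1 3 = r a b c 1 2" "r a b c 1 2 = r a b c 2 3"
  proof -
    have "(a - b)\<^sup>2 = b\<^sup>2" "a = sqrt (1 + b\<^sup>2)"
      using e ab by (simp_all add: r_explicit)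
    then have "a - b = b \<or> a - b = - b" and sq: "a\<^sup>2 = 1 + b\<^sup>2"
      by (simp_all only: power2_eq_iff) simp_all
    then have ab2: "a = 2 * b"
      using ab by linarith
    have "3 * b\<^sup>2 = 1"
      using sq unfolding ab2 by (simp add: power_mult_distrib)
    then have b: "b = 1 / sqrt 3"
      using ab ab2 eq_inverse_sqrt3_iff(1)[of b] by simp
    have "c\<^sup>2 \<le> b\<^sup>2"
      using ch(4) ab2 by (simp add: r_explicit power2_eq_square)
    then have "\<bar>c\<bar> \<le> b"
      using ab ab2 abs_le_square_iff[of c b] by simp
    then have "c = b \<or> c = - b \<or> (- b < c \<and> c < b)"
      by linarith
    then show ?thesis
      using b ab2 by (auto simp: C1_def P1_def P2_def)
  qed
  have side: ?thesis if e: "r a b c 1 3 = r a b c 1 2"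
  proof -
    \<comment> \<open>The first product of \<open>D\<close> vanishes, hence so does the second.
      Whichever factor is zero, the chain collapses to equal lateral sides or to the equilateral
      triangle.\<close>
    have "(r a b c 1 2 ^ 3 - r a b c 1 4 ^ 3) * (r a b c 2 4 ^ 3 - r a b c 3 4 ^ 3)
       * (r a b c 1 3 ^ 3 - r a b c 2 3 ^ 3) = 0"
      using D0 e by (simp add: D_def)
    then have "r a b c 1 2 = r a b c 1 4 \<or> r a b c 2 4 = r a b c 3 4 \<or> r a b c 1 3 = r a b c 2 3"
      by (simp add: cube)
    then have "r a b c 2 3 = r a b c 1 4 \<or> r a b c 1 3 = r a b c 2 3"
      using ch by linarith
    then show ?thesis
      using lateral triangle e by auto
  qed
  \<comment> \<open>The two equalities force \<open>b = a + c\<close>, a parallelogram; its equal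
    bases again make the lateral sides equal.\<close>
  have kite: ?thesis if e: "r a b c 1 2 = r a b c 2 3" "r a b c 1 4 = r a b c 3 4"
  proof -
    have "a\<^sup>2 = 1 + (a - b)\<^sup>2"
      using arg_cong[OF e(1), of "\<lambda>x. x\<^sup>2"] ab by (simp add: r_explicit)
    moreover have "1 + c\<^sup>2 = (b - c)\<^sup>2"
      using arg_cong[OF e(2), of "\<lambda>x. x\<^sup>2"] ab by (simp add: r_explicit)
    ultimately have "b * (a - c) = 1" "b * (a + c - b) = 0"
      by (simp_all add: power2_eq_square algebra_simps)
    then have "b = a + c" by auto
    then have "r a b c 3 4 = r a b c 1 2"
      using ab by (simp add: r_explicit)
    then show ?thesis
      using ch lateral by auto
  qed
  have side': ?thesis if e: "r a b c 1 2 = r a b c 2 3"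
  proof -
    \<comment> \<open>One equality between adjacent sides turns \<open>D\<close> into a product of
      three differences; likewise in the last case below.\<close>
    have "(r a b c 1 3 ^ 3 - r a b c 1 2 ^ 3) * (r a b c 2 4 ^ 3 - r a b c 2 3 ^ 3)
       * (r a b c 1 4 ^ 3 - r a b c 3 4 ^ 3) = 0"
      using D0 unfolding D_def e by algebra
    then have "r a b c 1 3 = r a b c 1 2 \<or> r a b c 2 4 = r a b c 2 3 \<or> r a b c 1 4 = r a b c 3 4"
      by (simp add: cube)
    then have "r a b c 1 3 = r a b c 1 2 \<or> r a b c 2 4 = r a b c 1 3 \<or> r a b c 1 4 = r a b c 3 4"
      using ch e by linarith
    then show ?thesis
      using side diagonals kite[OF e] by blast
  qed
  have ?thesis if e: "r a b c 1 4 = r a b c 3 4"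
  proof -
    have "(r a b c 2 4 ^ 3 - r a b c 1 4 ^ 3) * (r a b c 1 3 ^ 3 - r a b c 1 4 ^ 3)
       * (r a b c 2 3 ^ 3 - r a b c 1 2 ^ 3) = 0"
      using D0 unfolding D_def e by algebra
    then have "r a b c 2 4 = r a b c 1 4 \<or> r a b c 1 3 = r a b c 1 4 \<or> r a b c 2 3 = r a b c 1 2"
      by (simp add: cube)
    then have "r a b c 2 3 = r a b c 1 4 \<or> r a b c 1 2 = r a b c 2 3"
      using ch by linarith
    then show ?thesis
      using lateral side' by blast
  qed
  then show ?thesis
    using assms(2) lateral diagonals side side' by blast
qed

lemma sqrt_gt_neg_twice:
  assumes "- (1 / sqrt 3) < c" "c \<le> 0"
  shows "- (2 * c) < sqrt (1 + c\<^sup>2)"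
  using assms eq_inverse_sqrt3_iff(2)[of "- c"]
  by (intro real_less_rsqrt) (simp add: power_mult_distrib)

lemma C2_rhombus:
  assumes "(a, b, c) \<in> C2"
  shows "ordered_D0 a b c" "b > c" "r a b c 1 2 < r a b c 1 3"
    "r a b c 1 2 = r a b c 2 3" "r a b c 2 3 = r a b c 3 4" "r a b c 3 4 = r a b c 1 4"
proof -
  have c: "- (1 / sqrt 3) < c" "c \<le> 0" and eq: "a = sqrt (1 + c\<^sup>2)" "b = c + sqrt (1 + c\<^sup>2)"
    using assms by (auto simp: C2_def)
  note d = sqrt_gt_neg_twice[OF c]
  show "ordered_D0 a b c"
    unfolding eq using c d by (intro rhombus_ordered) auto
  show "r a b c 1 2 < r a b c 1 3"
    unfolding eq using c d by (intro rhombus_strict) auto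
  show "b > c" "r a b c 1 2 = r a b c 2 3" "r a b c 2 3 = r a b c 3 4" "r a b c 3 4 = r a b c 1 4"
    unfolding eq by (simp_all add: rhombus_r add_pos_nonneg)
qed

lemma C3_isosceles:
  assumes "(a, b, c) \<in> C3"
  shows "ordered_D0 a b c" "b > c" "r a b c 1 2 < r a b c 1 3" "a = b + c"
     "r a b c 2 4 = r a b c 1 3" "r a b c 2 3 = r a b c 1 4"
  using assms isosceles_ordered[of b c] eq_inverse_sqrt3_iff(2)[of c]
  by (auto simp: C3_def)

lemma boundary_Omega_iff:
  "(a, b, c) \<in> boundary_Omega \<longleftrightarrow> ordered_D0 a b c \<and>
    (r a b c 2 4 = r a b c 1 3 \<or> r a b c 1 3 = r a b c 1 2 \<or> r a b c 1 2 = r a b c 2 3 \<or>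
         r a b c 2 3 = r a b c 1 4 \<or> r a b c 1 4 = r a b c 3 4)"
  by (auto simp: boundary_Omega_def ordered_D0_def)

lemma P3_rhombus:
  "ordered_D0 1 1 0" "r 1 1 0 1 2 = 1" "r 1 1 0 2 3 = 1" "r 1 1 0 3 4 = 1" "r 1 1 0 1 4 = 1"
  "r 1 1 0 1 3 = sqrt 2" "r 1 1 0 2 4 = sqrt 2"
  using rhombus_ordered[of 0] by (simp_all add: r_explicit)

lemma boundary_Omega_eq: "boundary_Omega = C1 \<union> C2 \<union> C3 \<union> {P1} \<union> {P2} \<union> {P3}"
proof (intro set_eqI iffI)
  fix p assume p: "p \<in> boundary_Omega"
  obtain a b c where "p = (a, b, c)" by (cases p)
  then show "p \<in> C1 \<union> C2 \<union> C3 \<union> {P1} \<union> {P2} \<union> {P3}"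
    using p ordered_boundary_cases[of a b c] by (simp only: boundary_Omega_iff)
next
  fix p assume p: "p \<in> C1 \<union> C2 \<union> C3 \<union> {P1} \<union> {P2} \<union> {P3}"
  obtain a b c where abc: "p = (a, b, c)" by (cases p)
  define t :: real where "t = 1 / sqrt 3"
  have t: "2 / sqrt 3 = 2 * t" "t > 0"
    by (simp_all add: t_def)
  \<comment> \<open>\<open>C1\<close>, \<open>P1\<close> and \<open>P2\<close> together form one
    closed segment and are treated as a single case.\<close>
  consider "a = 2 * t" "b = t" "- t \<le> c" "c \<le> t" | "(a, b, c) \<in> C2" | "(a, b, c) \<in> C3" | "(a, b, c) = P3"
    using p t unfolding abc C1_def P1_def P2_def t_def[symmetric] by auto
  then have "(a, b, c) \<in> boundary_Omega"
  proof cases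
    case 1
    then show ?thesis
      using equilateral_ordered[of c] equilateral_r[of c] by (simp add: boundary_Omega_iff t_def)
  next
    case 2
    then show ?thesis using C2_rhombus by (simp add: boundary_Omega_iff)
  next
    case 3
    then show ?thesis using C3_isosceles by (simp add: boundary_Omega_iff)
  next
    case 4
    then show ?thesis using P3_rhombus by (simp add: boundary_Omega_iff P3_def)
  qed
  then show "p \<in> boundary_Omega" by (simp add: abc)
qed

section \<open>Configurations on the boundary\<close>

lemma restricted_massesI:
  assumes "\<And>i. 0 \<le> m $ i" "m $ i = 0" "0 < m $ j" "0 < m $ k" "j \<noteq> k"
  shows "restricted_masses m"
proof -
  have "card {j, k} \<le> card {i. 0 < m $ i}"
    using assms by (intro card_mono) auto
  then show ?thesis
    using assms by (auto simp: restricted_masses_def)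
qed

lemma dist_positions: "dist (positions a b c $ i) (positions a b c $ j) = r a b c i j"
  by (simp add: r_def dist_norm)

lemma equilateral_triangle_positions:
  fixes c :: real
  defines "t \<equiv> 1 / sqrt 3"
  assumes "- t \<le> c" "c \<le> t"
  shows "equilateral_triangle (positions (2 * t) t c $ 1) (positions (2 * t) t c $ 2) (positions (2 * t) t c $ 3)"
  using equilateral_r[of c] assms
  unfolding equilateral_triangle_def dist_positions r_commute[of _ _ _ 3 1]
  by (simp add: t_def)

lemma rhombus_positions:
  assumes "a > 0" "r a b c 1 2 = r a b c 2 3" "r a b c 2 3 = r a b c 3 4" "r a b c 3 4 = r a b c 1 4"
  shows "rhombus (positions a b c $ 1) (positions a b c $ 2) (positions a b c $ 3) (positions a b c $ 4)"
  using assms unfolding rhombus_def dist_positions r_commute[of _ _ _ 4 1] by simp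

text \<open>With \<open>\<nu>\<close> the inverse cube of the side, \<open>s\<close> vanishes on the
  triangle, so only the equations of the massless body 4 remain. It is closer than a side to bodies
  1 and 3 and farther from 2, which yields the signs needed for positive masses.\<close>

lemma equilateral_restricted:
  fixes c :: real
  defines "t \<equiv> 1 / sqrt 3"
  assumes c: "- t < c" "c < t"
  shows "\<exists>m. restricted_masses m \<and> 0 < m $ 1 \<and> 0 < m $ 2 \<and> 0 < m $ 3 \<and> m $ 4 = 0 \<and>
          central_configuration m (positions (2 * t) t c)"
proof -
  note t = inverse_sqrt3[folded t_def]
  note r = equilateral_r[of c, folded t_def, OF less_imp_le[OF c(1)] less_imp_le[OF c(2)]]
  have ord: "ordered_D0 (2 * t) t c"
    using equilateral_ordered[of c] c by (simp add: t_def)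
  then have t1: "2 * t \<ge> 1" by (simp add: ordered_D0_def)
  note rpos = r_pos[OF t1 c(2)]
  define s where "s i j = 1 / r (2 * t) t c i j ^ 3 - 1 / (2 * t) ^ 3" for i j
  have less: "r (2 * t) t c 1 4 < 2 * t" "2 * t < r (2 * t) t c 2 4" "r (2 * t) t c 3 4 < 2 * t"
  proof -
    have "c\<^sup>2 < t\<^sup>2"
      using c power2_strict_mono[of c t] by (simp add: abs_less_iff)
    then show "r (2 * t) t c 1 4 < 2 * t"
      unfolding r using t(4) by (metis add_strict_left_mono real_sqrt_less_iff)
    have "t\<^sup>2 < (2 * t - c)\<^sup>2"
      using c t by (intro power_strict_mono) auto
    then show "2 * t < r (2 * t) t c 2 4"
      unfolding r using t(4) by (metis add_strict_left_mono real_sqrt_less_iff)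
    show "r (2 * t) t c 3 4 < 2 * t"
      unfolding r using c t by linarith
  qed
  have s: "s 1 4 > 0" "s 2 4 < 0" "s 3 4 > 0"
    using inverse_cube_less[OF rpos(3) less(1)] inverse_cube_less[OF _ less(2)]
      inverse_cube_less[OF rpos(6) less(3)] t(1)
    unfolding s_def by linarith+
  have s0: "s 1 2 = 0" "s 1 3 = 0" "s 2 3 = 0"
    by (simp_all add: s_def r)
  \<comment> \<open>With \<open>m$2 = 1\<close>, the two equations of body 4 determine
    \<open>m$1\<close> and \<open>m$3\<close>.\<close>
  define m :: "real^4" where
    "m = vector [- s 2 4 / s 1 4, 1, - (2 * t * s 2 4) / ((t - c) * s 3 4), 0]"
  have m: "0 < m $ 1" "0 < m $ 2" "0 < m $ 3" "m $ 4 = 0"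
    using s t(1) c by (simp_all add: m_def zero_less_divide_iff divide_less_0_iff mult_less_0_iff mult_pos_neg)
  then have "\<forall>i. 0 \<le> m $ i" by (simp add: forall_4)
  moreover have "(\<Sum>k\<in>UNIV. m $ k) > 0"
    using m by (simp add: sum_4)
  moreover have "balanced (1 / (2 * t) ^ 3) m (positions (2 * t) t c)"
    unfolding balanced_positions s_def[symmetric] s0 using s c by (simp add: m_def)
  ultimately show ?thesis
    using m t1 t(1) c positions_distinct[of "2 * t" t c]
    by (intro exI[of _ m]) (auto simp: central_configuration_iff_balanced intro!: restricted_massesI[of m 4 1 2] exI[of _ "1 / (2 * t) ^ 3"])
qed

text \<open>All distances between distinct positions equal the side, so their \<open>s\<close>
  vanishes; \<open>r 3 4 = 0\<close> enters only with the factor \<open>b - c = 0\<close>.\<close>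

lemma collision_restricted:
  fixes t :: real
  defines "t \<equiv> 1 / sqrt 3"
  shows "\<exists>m. restricted_masses m \<and> 0 < m $ 1 \<and> 0 < m $ 2 \<and>
          collision_central_configuration m (positions (2 * t) t t)"
proof -
  note t = inverse_sqrt3[folded t_def]
  have r: "r (2 * t) t t 1 2 = 2 * t" "r (2 * t) t t 1 3 = 2 * t" "r (2 * t) t t 2 3 = 2 * t"
    "r (2 * t) t t 1 4 = 2 * t" "r (2 * t) t t 2 4 = 2 * t"
    using t by (simp_all add: r_explicit)
  define m :: "real^4" where "m = vector [1, 1, 1, 0]"
  have m: "m $ 1 = 1" "m $ 2 = 1" "m $ 3 = 1" "m $ 4 = 0"
    by (simp_all add: m_def)
  have "balanced (1 / (2 * t) ^ 3) m (positions (2 * t) t t)"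
    unfolding balanced_positions r by simp
  moreover have "\<exists>i j. i \<noteq> j \<and> positions (2 * t) t t $ i = positions (2 * t) t t $ j"
    by (rule exI[of _ 3], rule exI[of _ 4]) simp
  moreover have "(\<Sum>k\<in>UNIV. m $ k) > 0"
    by (simp add: sum_4 m)
  moreover have "1 / (2 * t) ^ 3 > 0" using t by simp
  ultimately have "collision_central_configuration m (positions (2 * t) t t)"
    using collision_central_configuration_iff_balanced by blast
  moreover have "\<forall>i. 0 \<le> m $ i" by (simp add: forall_4 m)
  ultimately show ?thesis
    using restricted_massesI[of m 4 1 2] by (intro exI[of _ m]) (auto simp: m)
qed

text \<open>The masses sit at the ends of the short diagonal, which is as long as a side. Only the
  distance 24 gives a nonzero \<open>s\<close>, and it occurs only with the vanishing masses
  \<open>m$2\<close> and \<open>m$4\<close>.\<close>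

lemma rhombus_restricted:
  fixes t :: real
  defines "t \<equiv> 1 / sqrt 3"
  shows "\<exists>m. restricted_masses m \<and> central_configuration m (positions (2 * t) t (- t))"
proof -
  note t = inverse_sqrt3[folded t_def]
  have "ordered_D0 (2 * t) t t"
    using equilateral_ordered[of t] t(1) by (simp add: t_def)
  then have t1: "2 * t \<ge> 1" by (simp add: ordered_D0_def)
  have r: "r (2 * t) t (- t) 1 2 = 2 * t" "r (2 * t) t (- t) 1 3 = 2 * t" "r (2 * t) t (- t) 2 3 = 2 * t"
    "r (2 * t) t (- t) 1 4 = 2 * t" "r (2 * t) t (- t) 3 4 = 2 * t"
    using t by (simp_all add: r_explicit)
  define m :: "real^4" where "m = vector [1, 0, 1, 0]"
  have m: "m $ 1 = 1" "m $ 2 = 0" "m $ 3 = 1" "m $ 4 = 0"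
    by (simp_all add: m_def)
  have "balanced (1 / (2 * t) ^ 3) m (positions (2 * t) t (- t))"
    unfolding balanced_positions r by (simp add: m)
  moreover have "\<forall>i. 0 \<le> m $ i" by (simp add: forall_4 m)
  moreover have "(\<Sum>k\<in>UNIV. m $ k) > 0"
    by (simp add: sum_4 m)
  moreover have "1 / (2 * t) ^ 3 > 0" using t by simp
  ultimately show ?thesis
    using restricted_massesI[of m 2 1 3] central_configuration_iff_balanced[of m "positions (2 * t) t (- t)"]
      positions_distinct[of "2 * t" t "- t"] t1 t(1)
    by (intro exI[of _ m]) (auto simp: m)
qed

lemma inner_vector2: "(vector [x, y] :: real^2) \<bullet> vector [x', y'] = x * x' + y * y'"
  by (simp add: inner_vec_def sum_2)

lemma isosceles_trapezoid_positions:
  assumes "c < b" "0 < a" "a = b + c"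
  shows "isosceles_trapezoid (positions a b c $ 1) (positions a b c $ 2) (positions a b c $ 3) (positions a b c $ 4)"
  unfolding isosceles_trapezoid_def
proof (intro conjI)
  have zero: "(vector [0, 0] :: real^2) = 0"
    by (simp add: vec_eq_iff forall_2)
  show "\<not> collinear {positions a b c $ 1, positions a b c $ 2, positions a b c $ 3}"
    using assms by (simp add: zero collinear_lemma) (simp add: vec_eq_iff forall_2)
  show "\<exists>t>0. positions a b c $ 2 - positions a b c $ 1 = t *\<^sub>R (positions a b c $ 3 - positions a b c $ 4)"
    using assms by (intro exI[of _ "a / (b - c)"]) (simp add: vec_eq_iff forall_2)
  show "dist (positions a b c $ 2) (positions a b c $ 3) = dist (positions a b c $ 4) (positions a b c $ 1)"
    unfolding dist_positions r_commute[of _ _ _ 4 1] using assms by (simp add: r_explicit)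
  \<comment> \<open>Eliminating \<open>b\<close> turns the cosines at the first base into the same
    expression; the other base is handled through its length \<open>d\<close>.\<close>
  have b: "b = a - c"
    using assms by simp
  obtain d where d: "d > 0" "a = 2 * c + d" "b = c + d"
    using assms that[of "b - c"] by simp
  have n: "norm (vector [x, y] :: real^2) = sqrt (x\<^sup>2 + y\<^sup>2)" for x y
    by (simp add: norm_vec_def L2_set_def sum_2)
  show "angle (positions a b c $ 4) (positions a b c $ 1) (positions a b c $ 2) =
      angle (positions a b c $ 1) (positions a b c $ 2) (positions a b c $ 3)"
    unfolding b using assms(2) by (simp add: angle_def inner_vector2 n mult_ac)
  show "angle (positions a b c $ 2) (positions a b c $ 3) (positions a b c $ 4) =
      angle (positions a b c $ 3) (positions a b c $ 4) (positions a b c $ 1)"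
    unfolding d(2,3) using d(1) by (simp add: angle_def inner_vector2 n mult_ac)
qed

theorem theorem8:
  shows "Omega =
      {(a, b, c). a \<ge> 1 \<and> b > c \<and> D a b c = 0 \<and>
         r a b c 2 4 \<ge> r a b c 1 3 \<and> r a b c 1 3 > r a b c 1 2 \<and> r a b c 1 2 \<ge> r a b c 2 3 \<and>
         r a b c 2 3 \<ge> r a b c 1 4 \<and> r a b c 1 4 \<ge> r a b c 3 4} \<and>
    boundary_Omega = C1 \<union> C2 \<union> C3 \<union> {P1} \<union> {P2} \<union> {P3} \<and>
    (\<forall>(a, b, c) \<in> C1. let q = positions a b c in
       equilateral_triangle (q $ 1) (q $ 2) (q $ 3) \<and>
       (\<exists>m. restricted_masses m \<and> 0 < m $ 1 \<and> 0 < m $ 2 \<and> 0 < m $ 3 \<and> m $ 4 = 0 \<and>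
          central_configuration m q)) \<and>
    (\<forall>(a, b, c) \<in> C2. let q = positions a b c in
       rhombus (q $ 1) (q $ 2) (q $ 3) (q $ 4) \<and> realizable a b c) \<and>
    (\<forall>(a, b, c) \<in> C3. let q = positions a b c in
       isosceles_trapezoid (q $ 1) (q $ 2) (q $ 3) (q $ 4) \<and> realizable a b c) \<and>
    (case P1 of (a, b, c) \<Rightarrow> let q = positions a b c in
       equilateral_triangle (q $ 1) (q $ 2) (q $ 3) \<and> q $ 3 = q $ 4 \<and>
       (\<exists>m. restricted_masses m \<and> 0 < m $ 1 \<and> 0 < m $ 2 \<and>
          collision_central_configuration m q)) \<and>
    (case P2 of (a, b, c) \<Rightarrow> let q = positions a b c in
       rhombus (q $ 1) (q $ 2) (q $ 3) (q $ 4) \<and>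
       equilateral_triangle (q $ 1) (q $ 2) (q $ 3) \<and>
       (\<exists>m. restricted_masses m \<and> central_configuration m q)) \<and>
    (case P3 of (a, b, c) \<Rightarrow> let q = positions a b c in
       square (q $ 1) (q $ 2) (q $ 3) (q $ 4) \<and> realizable a b c)"
  (is "?O \<and> ?B \<and> ?C1 \<and> ?C2 \<and> ?C3 \<and> ?P1 \<and> ?P2 \<and> ?P3")
proof (intro conjI)
  define t :: real where "t = 1 / sqrt 3"
  have t: "1 / sqrt 3 = t" "2 / sqrt 3 = 2 * t" "t > 0" and t': "sqrt (1 + t\<^sup>2) = 2 * t"
    using inverse_sqrt3 by (simp_all add: t_def)
  show ?O by (rule Omega_eq)
  show ?B by (rule boundary_Omega_eq)
  show ?C1
  proof -
    have "equilateral_triangle (positions (2 * t) t c $ 1) (positions (2 * t) t c $ 2) (positions (2 * t) t c $ 3) \<and>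
        (\<exists>m. restricted_masses m \<and> 0 < m $ 1 \<and> 0 < m $ 2 \<and> 0 < m $ 3 \<and> m $ 4 = 0 \<and>
          central_configuration m (positions (2 * t) t c))" if "- t < c" "c < t" for c
      using equilateral_triangle_positions[of c] equilateral_restricted[of c] that unfolding t by (simp del: positions_nth)
    then show ?thesis
      unfolding C1_def Let_def t by (auto simp del: positions_nth)
  qed
  show ?C2
    unfolding Let_def
  proof (clarify, rule conjI)
    fix a b c assume abc: "(a, b, c) \<in> C2"
    note C2 = C2_rhombus[OF abc]
    have "a > 0" using C2(1) by (simp add: ordered_D0_def)
    then show "rhombus (positions a b c $ 1) (positions a b c $ 2) (positions a b c $ 3) (positions a b c $ 4)"
      using C2(4-6) by (rule rhombus_positions)
    show "realizable a b c"
      using C2(1-3) by (rule ordered_D0_realizable)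
  qed
  show ?C3
    unfolding Let_def
  proof (clarify, rule conjI)
    fix a b c assume abc: "(a, b, c) \<in> C3"
    note C3 = C3_isosceles[OF abc]
    have "a > 0" using C3(1) by (simp add: ordered_D0_def)
    with C3(2) show "isosceles_trapezoid (positions a b c $ 1) (positions a b c $ 2)
        (positions a b c $ 3) (positions a b c $ 4)"
      using C3(4) by (rule isosceles_trapezoid_positions)
    show "realizable a b c"
      using C3(1-3) by (rule ordered_D0_realizable)
  qed
  show ?P1
    using equilateral_triangle_positions[of t] collision_restricted t(3)
    unfolding P1_def Let_def t by simp
  have "rhombus (positions (2 * t) t (- t) $ 1) (positions (2 * t) t (- t) $ 2)
      (positions (2 * t) t (- t) $ 3) (positions (2 * t) t (- t) $ 4)"
    using t(3) t' by (intro rhombus_positions) (simp_all add: r_explicit)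
  then show ?P2
    using equilateral_triangle_positions[of "- t"] rhombus_restricted t(3)
    unfolding P2_def Let_def t by simp
  have "realizable 1 1 0"
    by (rule ordered_D0_realizable) (simp_all add: P3_rhombus)
  moreover have "rhombus (positions 1 1 0 $ 1) (positions 1 1 0 $ 2) (positions 1 1 0 $ 3) (positions 1 1 0 $ 4)"
    by (rule rhombus_positions) (simp_all add: P3_rhombus)
  ultimately show ?P3
    by (simp add: P3_def Let_def square_def orthogonal_def inner_vector2)
qed

end
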